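(* Let $K$ be a field and let $n \ge 3$; if $K$ is infinite, assume moreover that $n \ge 4$. Let $\Omega, \Psi$ be conjugacy classes of the special linear group $\mathrm{SL}(n,K)$, and assume that both $\Omega$ and $\Psi$ are nonscalar. Then $\{\operatorname{tr}(\omega\psi) : \omega \in \Omega,\ \psi \in \Psi\} = K$.
   Context: A conjugacy class of $\mathrm{SL}(n,K)$ is an orbit of $\mathrm{SL}(n,K)$ acting on itself by conjugation (conjugating matrices have determinant $1$). A class is nonscalar if its elements are not scalar multiples of the identity matrix. *)

theory Defs
  imports
    "Jordan_Normal_Form.Determinant"
    "HOL-Algebra.Group_Action"
begin

definition SL :: "nat \<Rightarrow> 'a :: field mat monoid" where
  "SL n = \<lparr>carrier = {A \<in> carrier_mat n n. det A = 1}, mult = (*), one = 1\<^sub>m n\<rparr>"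

lemma group_SL: "group (SL n :: 'a :: field mat monoid)"
proof (rule groupI)
  fix A :: "'a mat"
  assume "A \<in> carrier (SL n)"
  then have A: "A \<in> carrier_mat n n" and d: "det A = 1"
    by (auto simp: SL_def)
  from det_non_zero_imp_unit[OF A, of n] d
  obtain B where B: "B \<in> carrier_mat n n" and BA: "B * A = 1\<^sub>m n"
    unfolding Units_def ring_mat_def by auto
  have "det B * det A = 1"
    using det_mult[OF B A] BA by simp
  with d have "det B = 1" by simp
  with B BA show "\<exists>B \<in> carrier (SL n). B \<otimes>\<^bsub>SL n\<^esub> A = \<one>\<^bsub>SL n\<^esub>"
    by (auto simp: SL_def)
qed (auto simp: SL_def det_mult assoc_mult_mat[of _ n n _ n _ n])


definition conjugacy_classes :: "('a, 'b) monoid_scheme \<Rightarrow> 'a set set" where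
  "conjugacy_classes G =
     orbits G (carrier G) (\<lambda>g. \<lambda>h \<in> carrier G. g \<otimes>\<^bsub>G\<^esub> h \<otimes>\<^bsub>G\<^esub> inv\<^bsub>G\<^esub> g)"

definition scalar_mat :: "nat \<Rightarrow> 'a :: field mat \<Rightarrow> bool" where
  "scalar_mat n A \<longleftrightarrow> (\<exists>c. A = c \<cdot>\<^sub>m 1\<^sub>m n)"

definition trace :: "'a :: comm_monoid_add mat \<Rightarrow> 'a" where
  "trace A = (\<Sum>i<dim_row A. A $$ (i, i))"

end

theory Submission
  imports Defs "Jordan_Normal_Form.Column_Operations"
begin

text \<open>If \<open>\<phi>\<close> is a functional with \<open>\<phi> x = \<phi> (A x) = 0\<close> and \<open>\<phi> (A B x) \<noteq> \<phi> (B A x)\<close>, then conjugating \<open>B\<close> by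
  the transvections \<open>1 + t x \<phi>\<close> makes the trace of the product a nonconstant affine function of \<open>t\<close>,
  which takes every value; likewise if \<open>\<phi> (B x) = 0\<close> replaces \<open>\<phi> (A x) = 0\<close>. As \<open>A\<close> and \<open>B\<close> are
  nonscalar, they can be conjugated so that \<open>A e\<^sub>0 = e\<^sub>2\<close> and \<open>B e\<^sub>0 = e\<^sub>1\<close> (indices start at 0). One more
  conjugation by a transvection makes \<open>\<phi> (A B e\<^sub>0)\<close> and \<open>\<phi> (B A e\<^sub>0)\<close> differ for a coordinate functional
  \<open>\<phi>\<close>; which transvection serves depends on whether \<open>B\<^sup>2 x \<in> \<langle>x, B x\<rangle>\<close> for all \<open>x\<close>.\<close>

section \<open>Conjugation by matrices of determinant 1\<close>

text \<open>\<open>similar_mat_wit\<close> makes \<open>Q\<close> the inverse of \<open>P\<close>,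
  so a condition on \<open>det P\<close> alone puts both in the special linear group. The dimension
  is read off from the matrices.\<close>

definition sl_similar :: "'a :: field mat \<Rightarrow> 'a mat \<Rightarrow> bool" where
  "sl_similar A B \<longleftrightarrow> (\<exists>P Q. similar_mat_wit A B P Q \<and> det P = 1)"

lemma sl_similar_carrier:
  assumes "sl_similar A B" "B \<in> carrier_mat n n"
  shows "A \<in> carrier_mat n n"
proof -
  obtain P Q where "similar_mat_wit A B P Q"
    using assms(1) unfolding sl_similar_def by blast
  from similar_mat_witD2(5)[OF assms(2) similar_mat_wit_sym[OF this]] show ?thesis .
qed

lemma sl_similar_refl: "A \<in> carrier_mat n n \<Longrightarrow> sl_similar A A"
  unfolding sl_similar_def by (intro exI conjI) (erule similar_mat_wit_refl, rule det_one)

lemma sl_similar_trans: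
  assumes "sl_similar A B" "sl_similar B C"
  shows "sl_similar A C"
proof -
  obtain P Q P' Q' where w: "similar_mat_wit A B P Q" "det P = 1"
    and w': "similar_mat_wit B C P' Q'" "det P' = 1"
    using assms unfolding sl_similar_def by blast
  have P: "P \<in> carrier_mat (dim_row A) (dim_row A)"
    using similar_mat_witD(6)[OF refl w(1)] .
  moreover have "B \<in> carrier_mat (dim_row A) (dim_row A)"
    using similar_mat_witD(5)[OF refl w(1)] .
  then have "P' \<in> carrier_mat (dim_row A) (dim_row A)"
    using similar_mat_witD2(6)[OF _ w'(1)] by blast
  ultimately have "det (P * P') = 1"
    using w(2) w'(2) by (simp add: det_mult)
  then show ?thesis
    unfolding sl_similar_def using similar_mat_wit_trans[OF w(1) w'(1)] by blast
qed

lemma inverse_of_det_1: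
  fixes P :: "'a :: field mat"
  assumes P: "P \<in> carrier_mat n n" and d: "det P = 1"
  obtains Q where "Q \<in> carrier_mat n n" "P * Q = 1\<^sub>m n" "Q * P = 1\<^sub>m n"
proof -
  from det_non_zero_imp_unit[OF P, of n] d
  obtain Q where Q: "Q \<in> carrier_mat n n" "Q * P = 1\<^sub>m n"
    unfolding Units_def ring_mat_def by auto
  with mat_mult_left_right_inverse[OF Q(1) P Q(2)] that show thesis by blast
qed

text \<open>The operation is conjugation by the transvection \<open>1 - a E\<^sub>k\<^sub>l\<close>,
  whose determinant is 1 because \<open>k \<noteq> l\<close>.\<close>

lemma sl_similar_add_col_sub_row:
  fixes A :: "'a :: field mat"
  assumes A: "A \<in> carrier_mat n n" and kl: "k < n" "l < n" "k \<noteq> l"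
  shows "sl_similar (add_col_sub_row a k l A) A"
proof -
  let ?P = "addrow_mat n (-a) k l"
  let ?Q = "addrow_mat n a k l"
  let ?B = "add_col_sub_row a k l A"
  have "?B = ?P * (A * ?Q)"
    unfolding add_col_sub_row_def addcol_mat[OF A kl(1)]
    by (rule addrow_mat[OF _ kl(2), of _ n]) (use A in simp)
  then have "?B = ?P * A * ?Q"
    using A by (simp add: assoc_mult_mat[of _ n n _ n _ n])
  moreover have "?B \<in> carrier_mat n n" using A by simp
  ultimately have "similar_mat_wit ?B A ?P ?Q"
    using A addrow_mat_inv[OF kl, of a] addrow_mat_inv[OF kl, of "-a"]
    by (intro similar_mat_witI[of ?P ?Q n]) (assumption | simp)+
  then show ?thesis
    unfolding sl_similar_def using det_addrow_mat[OF kl(3)] by blast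
qed

section \<open>The trace of a product under conjugation by a transvection\<close>

lemma mult_mat_unit_vec:
  fixes A :: "'a :: semiring_1 mat"
  assumes "A \<in> carrier_mat nr n" "i < n"
  shows "A *\<^sub>v unit_vec n i = col A i"
  using col_mult2[OF assms(1) one_carrier_mat assms(2)] right_mult_one_mat[of A nr n] assms
  by (simp del: col_mult2)

lemma index_mult_mat_sum:
  assumes "A \<in> carrier_mat n n" "B \<in> carrier_mat n n" "i < n" "j < n"
  shows "(A * B) $$ (i, j) = (\<Sum>l<n. A $$ (i, l) * B $$ (l, j))"
  using assms by (simp add: scalar_prod_def atLeast0LessThan)

text \<open>Expand \<open>A (1 - t E\<^sub>k\<^sub>l) B (1 + t E\<^sub>k\<^sub>l)\<close> and use
  that the trace of \<open>X E\<^sub>k\<^sub>l\<close> is the entry \<open>(l, k)\<close> of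
  \<open>X\<close>; the proof carries this out entrywise.\<close>

lemma trace_mult_add_col_sub_row:
  fixes A B :: "'a :: field mat"
  assumes A: "A \<in> carrier_mat n n" and B: "B \<in> carrier_mat n n"
    and kl: "k < n" "l < n" "k \<noteq> l"
  shows "trace (A * add_col_sub_row t k l B) =
    trace (A * B) + t * ((A * B) $$ (l, k) - (B * A) $$ (l, k))
    - t * t * (A $$ (l, k) * B $$ (l, k))"
proof -
  let ?C = "add_col_sub_row t k l B"
  have C: "?C \<in> carrier_mat n n" using B by simp
  have tr: "trace (A * X) = (\<Sum>i<n. \<Sum>j<n. A $$ (i, j) * X $$ (j, i))"
    if "X \<in> carrier_mat n n" for X
    using A that by (simp add: trace_def index_mult_mat_sum del: index_mult_mat(1))
  \<comment> \<open>Column \<open>l\<close> of \<open>B\<close> gains \<open>t\<close> times column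
    \<open>k\<close>, and row \<open>k\<close> loses \<open>t\<close> times row \<open>l\<close>.
    Both changes meet at the entry \<open>(k, l)\<close>, the source of the term in
    \<open>t * t\<close>.\<close>
  have entry: "A $$ (i, j) * ?C $$ (j, i) = A $$ (i, j) * B $$ (j, i)
      + (if i = l then t * (A $$ (l, j) * B $$ (j, k)) else 0)
      - (if j = k then t * (B $$ (l, i) * A $$ (i, k)) else 0)
      - (if j = k then if i = l then t * t * (A $$ (l, k) * B $$ (l, k)) else 0 else 0)"
    if "i < n" "j < n" for i j
    using that B kl by (cases "i = l"; cases "j = k") (simp_all add: algebra_simps)
  have row: "(\<Sum>j<n. A $$ (i, j) * ?C $$ (j, i)) = (\<Sum>j<n. A $$ (i, j) * B $$ (j, i))
      + (if i = l then t * (\<Sum>j<n. A $$ (l, j) * B $$ (j, k)) else 0)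
      - t * (B $$ (l, i) * A $$ (i, k))
      - (if i = l then t * t * (A $$ (l, k) * B $$ (l, k)) else 0)"
    if "i < n" for i
  proof -
    have "(\<Sum>j<n. A $$ (i, j) * ?C $$ (j, i)) = (\<Sum>j<n. A $$ (i, j) * B $$ (j, i))
        + (\<Sum>j<n. if i = l then t * (A $$ (l, j) * B $$ (j, k)) else 0)
        - (\<Sum>j<n. if j = k then t * (B $$ (l, i) * A $$ (i, k)) else 0)
        - (\<Sum>j<n. if j = k then if i = l then t * t * (A $$ (l, k) * B $$ (l, k)) else 0 else 0)"
      unfolding sum.distrib[symmetric] sum_subtractf[symmetric]
      using entry that by (intro sum.cong refl) simp
    then show ?thesis
      using kl by (simp only: sum.delta finite_lessThan lessThan_iff if_True) (simp add: sum_distrib_left)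
  qed
  have "trace (A * ?C) = (\<Sum>i<n. (\<Sum>j<n. A $$ (i, j) * B $$ (j, i))
      + (if i = l then t * (\<Sum>j<n. A $$ (l, j) * B $$ (j, k)) else 0)
      - t * (B $$ (l, i) * A $$ (i, k))
      - (if i = l then t * t * (A $$ (l, k) * B $$ (l, k)) else 0))"
    unfolding tr[OF C] using row by (intro sum.cong refl) simp
  also have "\<dots> = trace (A * B) + t * (A * B) $$ (l, k) - t * (B * A) $$ (l, k)
      - t * t * (A $$ (l, k) * B $$ (l, k))"
    unfolding tr[OF B] index_mult_mat_sum[OF A B kl(2,1)] index_mult_mat_sum[OF B A kl(2,1)]
      sum.distrib sum_subtractf sum_distrib_left[symmetric]
    using kl by (simp only: sum.delta finite_lessThan lessThan_iff if_True)
  finally show ?thesis by (simp only: right_diff_distrib add_diff_eq)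
qed

text \<open>Here \<open>x\<close> is the unit vector \<open>k\<close> and the functional is
  coordinate \<open>l\<close>. Assumption \<open>z\<close> kills the quadratic term and
  \<open>ne\<close> makes the linear coefficient invertible, so the equation can be solved for
  \<open>t\<close>.\<close>

lemma trace_mult_sl_similar_surj:
  fixes A B :: "'a :: field mat"
  assumes A: "A \<in> carrier_mat n n" and B: "B \<in> carrier_mat n n"
    and kl: "k < n" "l < n" "k \<noteq> l"
    and z: "A $$ (l, k) = 0 \<or> B $$ (l, k) = 0"
    and ne: "(A * B) $$ (l, k) \<noteq> (B * A) $$ (l, k)"
  shows "\<exists>B'. sl_similar B' B \<and> trace (A * B') = c"
proof -
  let ?d = "(A * B) $$ (l, k) - (B * A) $$ (l, k)"
  let ?t = "(c - trace (A * B)) / ?d"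
  have "?t * ?d = c - trace (A * B)" using ne by simp
  then have "trace (A * add_col_sub_row ?t k l B) = c"
    unfolding trace_mult_add_col_sub_row[OF A B kl] using z
    by (simp del: index_mult_mat times_divide_eq_left times_divide_eq_right)
  then show ?thesis using sl_similar_add_col_sub_row[OF B kl] by blast
qed

section \<open>Matrices of determinant 1 with prescribed first columns\<close>

text \<open>If \<open>w $ k\<close> is nonzero, put \<open>w\<close> into column \<open>k\<close> of
  the identity, which gives determinant \<open>w $ k\<close>, and correct this by rescaling column
  \<open>k + 1\<close>; hence the bound on \<open>k\<close>. Otherwise a transvection first makes
  that coordinate nonzero.\<close>

lemma SL_extend_unit_vecs:
  fixes w :: "'a :: field vec"
  assumes w: "w \<in> carrier_vec n" and kj: "k \<le> j" "j < n" and wj: "w $ j \<noteq> 0" and k: "k + 1 < n"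
  shows "\<exists>R \<in> carrier_mat n n. det R = 1 \<and> (\<forall>i<k. col R i = unit_vec n i) \<and> col R k = w"
proof -
  have nonzero_pivot: "\<exists>R \<in> carrier_mat n n. det R = 1 \<and> (\<forall>i<k. col R i = unit_vec n i) \<and> col R k = v"
    if v: "v \<in> carrier_vec n" and vk: "v $ k \<noteq> 0" for v :: "'a vec"
  proof -
    define M where "M = replace_col (1\<^sub>m n) v k"
    define D where "D = multrow_mat n (k + 1) (inverse (v $ k))"
    have M: "M \<in> carrier_mat n n" unfolding M_def replace_col_def by simp
    have D: "D \<in> carrier_mat n n" unfolding D_def by simp
    have "det M = v $ k"
      using cramer_lemma_mat[OF one_carrier_mat v] k v unfolding M_def by simp
    then have d: "det (M * D) = 1"
      using det_mult[OF M D] k vk by (simp add: D_def det_multrow_mat)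
    have c: "col (M * D) i = col M i" if "i \<le> k" for i
    proof -
      have "col D i = unit_vec n i" using that k by (simp add: D_def col_multrow)
      then show ?thesis
        using that k col_mult2[OF M D, of i] mult_mat_unit_vec[OF M, of i] by simp
    qed
    have "\<forall>i<k. col M i = unit_vec n i"
      using k by (auto simp: M_def replace_col_def intro!: eq_vecI)
    moreover have "col M k = v"
      using k v by (auto simp: M_def replace_col_def intro!: eq_vecI)
    ultimately show ?thesis
      using c d M D by (intro bexI[of _ "M * D"]) auto
  qed
  show ?thesis
  proof (cases "w $ k = 0")
    case False
    with nonzero_pivot w show ?thesis by blast
  next
    case True
    with kj wj have kj': "k < j" by (metis le_neq_implies_less)
    \<comment> \<open>\<open>S\<close> adds coordinate \<open>j\<close> to coordinate
      \<open>k\<close>. As \<open>j > k\<close>, its inverse \<open>S'\<close> fixes the unit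
      vectors below \<open>k\<close>, so undoing \<open>S\<close> keeps the earlier columns.\<close>
    define S where "S = addrow_mat n (1 :: 'a) k j"
    define S' where "S' = addrow_mat n (-1 :: 'a) k j"
    have S: "S \<in> carrier_mat n n" "S' \<in> carrier_mat n n" by (auto simp: S_def S'_def)
    have S'S: "S' * S = 1\<^sub>m n"
      using addrow_mat_inv[of k n j "-1 :: 'a"] kj kj' by (simp add: S_def S'_def)
    have Sw: "(S *\<^sub>v w) $ k \<noteq> 0"
    proof -
      have "(S *\<^sub>v w) $ k = (\<Sum>i\<in>{0..<n}. (if i = j then w $ i else 0) + (if i = k then w $ i else 0))"
        using S w kj kj' by (auto simp: S_def scalar_prod_def intro!: sum.cong)
      also have "\<dots> = w $ j" using True kj kj' by (simp add: sum.distrib)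
      finally show ?thesis using wj by simp
    qed
    obtain R where R: "R \<in> carrier_mat n n" "det R = 1" "\<forall>i<k. col R i = unit_vec n i"
      "col R k = S *\<^sub>v w"
      using nonzero_pivot[OF _ Sw] S w by auto
    have "col (S' * R) i = unit_vec n i" if "i < k" for i
    proof -
      have "col (S' * R) i = S' *\<^sub>v unit_vec n i"
        using that k R col_mult2[OF S(2) R(1), of i] by simp
      also have "\<dots> = col S' i"
        using that k by (intro mult_mat_unit_vec[OF S(2)]) simp
      also have "\<dots> = unit_vec n i" using that k kj' by (simp add: S'_def col_addrow)
      finally show ?thesis .
    qed
    moreover have "col (S' * R) k = w"
    proof -
      have "col (S' * R) k = S' *\<^sub>v (S *\<^sub>v w)"
        using R k col_mult2[OF S(2) R(1), of k] by simp
      also have "\<dots> = w"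
        using S w S'S by (simp flip: assoc_mult_mat_vec)
      finally show ?thesis .
    qed
    moreover have "det (S' * R) = 1"
      using det_mult[OF S(2) R(1)] R(2) kj' by (simp add: S'_def det_addrow_mat)
    ultimately show ?thesis using R S by (intro bexI[of _ "S' * R"]) auto
  qed
qed

text \<open>Complete \<open>x\<close> to a matrix \<open>R\<close>. In the basis of its columns
  \<open>y\<close> becomes \<open>z\<close>, which has a nonzero coordinate beyond the first, so
  \<open>z\<close> can be completed after the unit vector 0 to a matrix \<open>T\<close>; then
  \<open>R * T\<close> works.\<close>

lemma SL_first_columns:
  fixes x y :: "'a :: field vec"
  assumes n: "3 \<le> n" and x: "x \<in> carrier_vec n" and y: "y \<in> carrier_vec n"
    and x0: "x \<noteq> 0\<^sub>v n" and xy: "\<And>c. y \<noteq> c \<cdot>\<^sub>v x"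
  obtains P where "P \<in> carrier_mat n n" "det P = 1" "col P 0 = x" "col P 1 = y"
proof -
  obtain j where "j < n" "x $ j \<noteq> 0"
    using x x0 by (metis carrier_vecD eq_vecI index_zero_vec)
  then obtain R where R: "R \<in> carrier_mat n n" "det R = 1" "col R 0 = x"
    using SL_extend_unit_vecs[OF x, of 0 j] n by auto
  obtain R' where R': "R' \<in> carrier_mat n n" "R * R' = 1\<^sub>m n"
    using inverse_of_det_1[OF R(1,2)] by metis
  define z where "z = R' *\<^sub>v y"
  have z: "z \<in> carrier_vec n" using R' y by (simp add: z_def)
  have Rz: "R *\<^sub>v z = y"
    unfolding z_def using R R' y by (simp flip: assoc_mult_mat_vec)
  have "\<exists>i<n. 1 \<le> i \<and> z $ i \<noteq> 0"
  proof (rule ccontr)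
    assume "\<not> ?thesis"
    then have "z = z $ 0 \<cdot>\<^sub>v unit_vec n 0"
      using z n by (intro eq_vecI) (auto simp: Suc_le_eq)
    then have "R *\<^sub>v z = z $ 0 \<cdot>\<^sub>v (R *\<^sub>v unit_vec n 0)"
      using mult_mat_vec[OF R(1) unit_vec_carrier] by metis
    then show False using Rz xy R n by (simp add: mult_mat_unit_vec)
  qed
  then obtain i where "i < n" "1 \<le> i" "z $ i \<noteq> 0" by blast
  then obtain T where T: "T \<in> carrier_mat n n" "det T = 1" "col T 0 = unit_vec n 0" "col T 1 = z"
    using SL_extend_unit_vecs[OF z, of 1 i] n by auto
  show thesis
  proof (rule that)
    show "R * T \<in> carrier_mat n n" using R T by simp
    show "det (R * T) = 1" using R T by (simp add: det_mult)
    show "col (R * T) 0 = x" 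
      using col_mult2[OF R(1) T(1), of 0] mult_mat_unit_vec[OF R(1), of 0] R T n by simp
    show "col (R * T) 1 = y"
      using col_mult2[OF R(1) T(1), of 1] T n Rz by simp
  qed
qed

section \<open>Prescribing the first column by conjugation\<close>

text \<open>Rewrite \<open>B\<close> in a basis that starts with \<open>x\<close>,
  \<open>B x\<close>. The matrix \<open>P\<close> stays in the conclusion because column 1 of
  \<open>B'\<close> then holds the coordinates of \<open>B (B x)\<close> in that basis.\<close>

lemma sl_similar_cyclic_columns:
  fixes B :: "'a :: field mat"
  assumes n: "3 \<le> n" and B: "B \<in> carrier_mat n n" and x: "x \<in> carrier_vec n"
    and nx: "\<And>c. B *\<^sub>v x \<noteq> c \<cdot>\<^sub>v x"
  obtains B' P where "sl_similar B' B" "col B' 0 = unit_vec n 1"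
    "P \<in> carrier_mat n n" "P *\<^sub>v col B' 1 = B *\<^sub>v (B *\<^sub>v x)" "col P 0 = x" "col P 1 = B *\<^sub>v x"
proof -
  have "x \<noteq> 0\<^sub>v n"
  proof
    assume "x = 0\<^sub>v n"
    then have "B *\<^sub>v x = 1 \<cdot>\<^sub>v x" using B by auto
    then show False using nx by blast
  qed
  then obtain P where P: "P \<in> carrier_mat n n" "det P = 1" "col P 0 = x" "col P 1 = B *\<^sub>v x"
    by (rule SL_first_columns[OF n x mult_mat_vec_carrier[OF B x] _ nx])
  obtain Q where Q: "Q \<in> carrier_mat n n" "P * Q = 1\<^sub>m n" "Q * P = 1\<^sub>m n"
    using inverse_of_det_1[OF P(1,2)] .
  have "similar_mat_wit (Q * B * P) B Q P"
    using P Q B by (intro similar_mat_witI[of _ _ n]) auto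
  moreover have "det Q = 1"
    using det_mult[OF P(1) Q(1)] Q P by simp
  ultimately have sim: "sl_similar (Q * B * P) B" unfolding sl_similar_def by blast
  have c: "col (Q * B * P) i = Q *\<^sub>v (B *\<^sub>v col P i)" if "i < n" for i
  proof -
    have "col (Q * B * P) i = (Q * B) *\<^sub>v col P i"
      using that P Q B by (intro col_mult2[of _ n n _ n]) auto
    also have "\<dots> = Q *\<^sub>v (B *\<^sub>v col P i)"
      using that P Q B by (intro assoc_mult_mat_vec) auto
    finally show ?thesis .
  qed
  show thesis
  proof (rule that[OF sim _ P(1)])
    have "Q *\<^sub>v (B *\<^sub>v col P 0) = Q *\<^sub>v col P 1" using P by simp
    also have "\<dots> = col (Q * P) 1"
      using n by (intro col_mult2[OF Q(1) P(1), symmetric]) simp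
    finally show "col (Q * B * P) 0 = unit_vec n 1" using c n Q by simp
    have "P *\<^sub>v (Q *\<^sub>v (B *\<^sub>v col P 1)) = (P * Q) *\<^sub>v (B *\<^sub>v col P 1)"
      using P Q B n by (intro assoc_mult_mat_vec[symmetric]) auto
    then show "P *\<^sub>v col (Q * B * P) 1 = B *\<^sub>v (B *\<^sub>v x)"
      using c n Q P B x by simp
  qed (use P in auto)
qed

text \<open>If all unit vectors are eigenvectors, \<open>B\<close> is diagonal; if the sums of unit
  vectors 0 and \<open>i\<close> are too, the diagonal entries agree.\<close>

lemma ex_non_eigenvector:
  fixes B :: "'a :: field mat"
  assumes n: "3 \<le> n" and B: "B \<in> carrier_mat n n" and ns: "\<not> scalar_mat n B"
  shows "\<exists>x\<in>carrier_vec n. \<forall>c. B *\<^sub>v x \<noteq> c \<cdot>\<^sub>v x"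
proof (rule ccontr)
  assume "\<not> ?thesis"
  then have eig: "\<exists>c. B *\<^sub>v x = c \<cdot>\<^sub>v x" if "x \<in> carrier_vec n" for x
    using that by blast
  have "\<exists>c. col B i = c \<cdot>\<^sub>v unit_vec n i" if "i < n" for i
    using eig[of "unit_vec n i"] that B by (simp add: mult_mat_unit_vec)
  then obtain d where d: "col B i = d i \<cdot>\<^sub>v unit_vec n i" if "i < n" for i
    by metis
  have e: "B $$ (j, i) = (if j = i then d i else 0)" if "i < n" "j < n" for i j
  proof -
    have "B $$ (j, i) = col B i $ j" using that B by simp
    then show ?thesis using d that by simp
  qed
  have "d i = d 0" if i: "i < n" "i \<noteq> 0" for i
  proof -
    have e0: "unit_vec n 0 + unit_vec n i \<in> carrier_vec n" by simp
    then obtain c where "B *\<^sub>v (unit_vec n 0 + unit_vec n i) = c \<cdot>\<^sub>v (unit_vec n 0 + unit_vec n i)"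
      using eig by blast
    moreover have "B *\<^sub>v (unit_vec n 0 + unit_vec n i) = col B 0 + col B i"
      using B i n by (simp add: mult_add_distrib_mat_vec[of _ n n] mult_mat_unit_vec)
    ultimately have "(col B 0 + col B i) $ j = (c \<cdot>\<^sub>v (unit_vec n 0 + unit_vec n i)) $ j" for j
      by simp
    from this[of 0] this[of i] show ?thesis using i B n e by auto
  qed
  then have "B = d 0 \<cdot>\<^sub>m 1\<^sub>m n"
    using B e by (intro eq_matI) auto
  with ns show False unfolding scalar_mat_def by blast
qed

lemma index_0_of_col_0:
  assumes "A \<in> carrier_mat n n" "i < n" "col A 0 = unit_vec n k"
  shows "A $$ (i, 0) = (if i = k then 1 else 0)"
proof -
  have "A $$ (i, 0) = col A 0 $ i" using assms(1,2) by simp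
  then show ?thesis using assms(2,3) by (simp add: unit_vec_def)
qed

lemma ex_sl_similar_col_0_eq_unit_vec_1:
  fixes A :: "'a :: field mat"
  assumes n: "3 \<le> n" and A: "A \<in> carrier_mat n n" and ns: "\<not> scalar_mat n A"
  shows "\<exists>A'. sl_similar A' A \<and> col A' 0 = unit_vec n 1"
proof -
  obtain x where "x \<in> carrier_vec n" "\<And>c. A *\<^sub>v x \<noteq> c \<cdot>\<^sub>v x"
    using ex_non_eigenvector[OF n A ns] by blast
  then show ?thesis
    using sl_similar_cyclic_columns[OF n A] by metis
qed

text \<open>Two transvections fixing \<open>e\<^sub>0\<close> carry \<open>e\<^sub>1\<close> to
  \<open>e\<^sub>1 + e\<^sub>2\<close> and then to \<open>e\<^sub>2\<close>; a plain swap of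
  coordinates would have determinant -1.\<close>

lemma ex_sl_similar_col_0_eq_unit_vec_2:
  fixes A :: "'a :: field mat"
  assumes n: "3 \<le> n" and A: "A \<in> carrier_mat n n" and ns: "\<not> scalar_mat n A"
  shows "\<exists>A'. sl_similar A' A \<and> col A' 0 = unit_vec n 2"
proof -
  obtain A1 where A1: "sl_similar A1 A" "col A1 0 = unit_vec n 1"
    using ex_sl_similar_col_0_eq_unit_vec_1[OF assms] by blast
  have A1c: "A1 \<in> carrier_mat n n" using sl_similar_carrier[OF A1(1) A] .
  note e1 = index_0_of_col_0[OF A1c _ A1(2)]
  define A2 where "A2 = add_col_sub_row (-1) 2 1 A1"
  have A2: "sl_similar A2 A1" "A2 \<in> carrier_mat n n"
    using sl_similar_add_col_sub_row[OF A1c, of 2 1 "-1"] A1c n by (simp_all add: A2_def)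
  have e2: "A2 $$ (i, 0) = (if i = 1 \<or> i = 2 then 1 else 0)" if "i < n" for i
    using that n A1c e1 by (auto simp: A2_def)
  define A3 where "A3 = add_col_sub_row 1 1 2 A2"
  have A3: "sl_similar A3 A2" "A3 \<in> carrier_mat n n"
    using sl_similar_add_col_sub_row[OF A2(2), of 1 2 1] A2 n by (simp_all add: A3_def)
  have "A3 $$ (i, 0) = (if i = 2 then 1 else 0)" if "i < n" for i
    using that n A2 e2 by (auto simp: A3_def)
  then have "col A3 0 = unit_vec n 2"
    using A3 n by (intro eq_vecI) auto
  then show ?thesis
    using sl_similar_trans[OF A3(1) sl_similar_trans[OF A2(1) A1(1)]] by blast
qed

section \<open>Attaining every trace\<close>

lemma index_mult_mat_col_0:
  fixes A B :: "'a :: comm_ring_1 mat"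
  assumes "A \<in> carrier_mat n n" "B \<in> carrier_mat n n" "i < n" "k < n" "col B 0 = unit_vec n k"
  shows "(A * B) $$ (i, 0) = A $$ (i, k)"
proof -
  have "(A * B) $$ (i, 0) = col (A * B) 0 $ i" using assms by simp
  also have "\<dots> = (A *\<^sub>v unit_vec n k) $ i"
    using col_mult2[OF assms(1,2), of 0] assms by simp
  also have "\<dots> = A $$ (i, k)"
    using assms(1,3,4) mult_mat_unit_vec[OF assms(1,4)] by simp
  finally show ?thesis .
qed

text \<open>Here \<open>B\<close> has a vector \<open>x = e\<^sub>0\<close> with \<open>x\<close>, \<open>Bx\<close>, \<open>B\<^sup>2x\<close> independent. Conjugating \<open>A\<close> by
  \<open>1 + t E\<^sub>1\<^sub>2\<close> changes the \<open>(k, 0)\<close> entry of \<open>BA\<close> by \<open>t B\<^sub>k\<^sub>1\<close> and leaves that of \<open>AB\<close> unchanged.\<close>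

lemma trace_surj_non_quadratic:
  fixes A B :: "'a :: field mat"
  assumes n: "3 \<le> n" and A: "A \<in> carrier_mat n n" and B: "B \<in> carrier_mat n n"
    and A0: "col A 0 = unit_vec n 2" and B0: "col B 0 = unit_vec n 1"
    and k: "2 \<le> k" "k < n" and Bk: "B $$ (k, 1) \<noteq> 0"
  shows "\<exists>A' B'. sl_similar A' A \<and> sl_similar B' B \<and> trace (A' * B') = c"
proof -
  \<comment> \<open>Chosen so that \<open>t * B $$ (k, 1) + B $$ (k, 2)\<close> differs from
    \<open>A $$ (k, 1)\<close>.\<close>
  define t where "t = (if A $$ (k, 1) = B $$ (k, 2) then 1 else 0 :: 'a)"
  define A' where "A' = add_col_sub_row (-t) 1 2 A"
  have A': "sl_similar A' A" "A' \<in> carrier_mat n n"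
    using sl_similar_add_col_sub_row[OF A, of 1 2 "-t"] A n by (simp_all add: A'_def)
  note a = index_0_of_col_0[OF A _ A0]
  have c0: "A' $$ (i, 0) = (if i = 1 then t else if i = 2 then 1 else 0)" if "i < n" for i
    using that n A a by (auto simp: A'_def)
  have "(B * A') $$ (k, 0) = (\<Sum>i<n. B $$ (k, i) * A' $$ (i, 0))"
    using index_mult_mat_sum[OF B A'(2) k(2), of 0] n by simp
  also have "\<dots> = (\<Sum>i<n. (if i = 1 then t * B $$ (k, 1) else 0) + (if i = 2 then B $$ (k, 2) else 0))"
    using c0 by (intro sum.cong) auto
  also have "\<dots> = t * B $$ (k, 1) + B $$ (k, 2)"
    using n by (simp add: sum.distrib)
  finally have BA: "(B * A') $$ (k, 0) = t * B $$ (k, 1) + B $$ (k, 2)" .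
  have "(A' * B) $$ (k, 0) = A' $$ (k, 1)"
    using index_mult_mat_col_0[OF A'(2) B k(2) _ B0] n by simp
  also have "\<dots> = A $$ (k, 1)" using n k A by (simp add: A'_def)
  finally have "(A' * B) $$ (k, 0) \<noteq> (B * A') $$ (k, 0)"
    using BA Bk by (auto simp: t_def)
  moreover have "B $$ (k, 0) = 0" using index_0_of_col_0[OF B k(2) B0] k by simp
  ultimately have "\<exists>B'. sl_similar B' B \<and> trace (A' * B') = c"
    using n k by (intro trace_mult_sl_similar_surj[OF A'(2) B, of 0 k]) auto
  then show ?thesis using A'(1) by blast
qed

text \<open>The functional is now coordinate 1, which vanishes on
  \<open>A e\<^sub>0 = e\<^sub>2\<close>. A transvection keeping column 0 of \<open>B\<close> shifts
  \<open>B $$ (1, 2)\<close> by \<open>t\<close> times a nonzero difference of diagonal entries, so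
  it can be moved away from \<open>A $$ (1, 1)\<close>.\<close>

lemma trace_surj_diagonal_entry:
  fixes A B :: "'a :: field mat"
  assumes n: "3 \<le> n" and A: "A \<in> carrier_mat n n" and B: "B \<in> carrier_mat n n"
    and A0: "col A 0 = unit_vec n 2" and B0: "col B 0 = unit_vec n 1"
    and B21: "B $$ (2, 1) = 0" and ne: "B $$ (2, 2) \<noteq> B $$ (1, 1)"
  shows "\<exists>A' B'. sl_similar A' A \<and> sl_similar B' B \<and> trace (A' * B') = c"
proof -
  define t where "t = (if B $$ (1, 2) = A $$ (1, 1) then -1 else 0 :: 'a)"
  define B' where "B' = add_col_sub_row t 1 2 B"
  have B': "sl_similar B' B" "B' \<in> carrier_mat n n"
    using sl_similar_add_col_sub_row[OF B, of 1 2 t] B n by (simp_all add: B'_def)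
  have "B' $$ (i, 0) = B $$ (i, 0)" if "i < n" for i
    using that n B index_0_of_col_0[OF B _ B0] by (simp add: B'_def)
  then have B'0: "col B' 0 = unit_vec n 1"
    using B B' B0 n index_0_of_col_0[OF B _ B0] by (intro eq_vecI) auto
  have "B' $$ (1, 2) = B $$ (1, 2) + t * (B $$ (1, 1) - B $$ (2, 2))"
    using n B B21 by (simp add: B'_def algebra_simps)
  then have "B' $$ (1, 2) \<noteq> A $$ (1, 1)" using ne by (auto simp: t_def)
  moreover have "(A * B') $$ (1, 0) = A $$ (1, 1)"
    using index_mult_mat_col_0[OF A B'(2) _ _ B'0] n by simp
  moreover have "(B' * A) $$ (1, 0) = B' $$ (1, 2)"
    using index_mult_mat_col_0[OF B'(2) A _ _ A0] n by simp
  moreover have "A $$ (1, 0) = 0" using index_0_of_col_0[OF A _ A0] n by simp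
  ultimately obtain B'' where "sl_similar B'' B'" "trace (A * B'') = c"
    using trace_mult_sl_similar_surj[OF A B'(2), of 0 1 c] n by auto
  then show ?thesis
    using sl_similar_refl[OF A] sl_similar_trans[OF _ B'(1)] by blast
qed

text \<open>If all vectors \<open>x\<close>, \<open>Bx\<close>, \<open>B\<^sup>2x\<close> are dependent, \<open>B\<close> acts on \<open>U = \<langle>e\<^sub>0, e\<^sub>1\<rangle>\<close> with trace \<open>a = B\<^sub>1\<^sub>1\<close> and
  nonzero determinant. If in addition \<open>B e\<^sub>2 \<in> a e\<^sub>2 + U\<close>, then, \<open>B - a\<close> being invertible on \<open>U\<close>,
  some \<open>v \<in> e\<^sub>2 + U\<close> satisfies \<open>Bv = av + e\<^sub>0\<close>, and \<open>v\<close>, \<open>Bv\<close>, \<open>B\<^sup>2v\<close> are independent.\<close>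

lemma ex_sl_similar_diagonal_entry:
  fixes B :: "'a :: field mat"
  assumes n: "3 \<le> n" and B: "B \<in> carrier_mat n n" and dB: "det B \<noteq> 0"
    and B0: "col B 0 = unit_vec n 1"
    and quad: "\<And>C k. \<lbrakk>sl_similar C B; col C 0 = unit_vec n 1; 2 \<le> k; k < n\<rbrakk> \<Longrightarrow> C $$ (k, 1) = 0"
  shows "\<exists>C. sl_similar C B \<and> col C 0 = unit_vec n 1 \<and> C $$ (2, 2) \<noteq> C $$ (1, 1)"
proof (rule ccontr)
  assume neg: "\<not> ?thesis"
  \<comment> \<open>By \<open>quad\<close>, \<open>B\<close> preserves the span of the first two
    unit vectors; its restriction has trace \<open>a\<close> and determinant
    \<open>d\<close>.\<close>
  define a where "a = B $$ (1, 1)"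
  define d where "d = - B $$ (0, 1)"
  note b0 = index_0_of_col_0[OF B _ B0]
  note b1 = quad[OF sl_similar_refl[OF B] B0]
  have b22: "B $$ (2, 2) = a"
    using neg sl_similar_refl[OF B] B0 by (auto simp: a_def)
  \<comment> \<open>A nonzero entry here could be subtracted from the diagonal entry
    \<open>(2, 2)\<close> by a transvection that leaves column 0 and the entry \<open>(1, 1)\<close>
    alone, contrary to \<open>neg\<close>.\<close>
  have b2: "B $$ (k, 2) = 0" if k: "3 \<le> k" "k < n" for k
  proof (rule ccontr)
    assume nz: "B $$ (k, 2) \<noteq> 0"
    define C where "C = add_col_sub_row 1 2 k B"
    have C: "sl_similar C B" "C \<in> carrier_mat n n"
      using sl_similar_add_col_sub_row[OF B, of 2 k 1] B k by (simp_all add: C_def)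
    have "C $$ (i, 0) = (if i = 1 then 1 else 0)" if "i < n" for i
      using that k B b0 by (auto simp: C_def)
    then have "col C 0 = unit_vec n 1"
      using C n by (intro eq_vecI) auto
    moreover have "C $$ (2, 2) = a - B $$ (k, 2)" "C $$ (1, 1) = a"
      using k B b22 by (auto simp: C_def a_def)
    ultimately show False using neg C nz by auto
  qed
  define u where "u i = (unit_vec n i :: 'a vec)" for i
  have u: "u i \<in> carrier_vec n" for i by (simp add: u_def)
  have Bu0: "B *\<^sub>v u 0 = u 1" using mult_mat_unit_vec[OF B, of 0] B0 n by (simp add: u_def)
  have Bu1: "B *\<^sub>v u 1 = a \<cdot>\<^sub>v u 1 - d \<cdot>\<^sub>v u 0"
  proof (rule eq_vecI)
    fix i assume "i < dim_vec (a \<cdot>\<^sub>v u 1 - d \<cdot>\<^sub>v u 0)"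
    then have i: "i < n" by (simp add: u_def)
    have "(B *\<^sub>v u 1) $ i = B $$ (i, 1)"
      using mult_mat_unit_vec[OF B, of 1] i n B by (simp add: u_def)
    then show "(B *\<^sub>v u 1) $ i = (a \<cdot>\<^sub>v u 1 - d \<cdot>\<^sub>v u 0) $ i"
      using i n b1[of i] by (cases "i = 0"; cases "i = 1") (auto simp: u_def a_def d_def)
  qed (use B in \<open>simp add: u_def\<close>)
  define \<alpha> \<beta> where "\<alpha> = B $$ (0, 2)" and "\<beta> = B $$ (1, 2)"
  have Bu2: "B *\<^sub>v u 2 = a \<cdot>\<^sub>v u 2 + \<alpha> \<cdot>\<^sub>v u 0 + \<beta> \<cdot>\<^sub>v u 1"
  proof (rule eq_vecI)
    fix i assume "i < dim_vec (a \<cdot>\<^sub>v u 2 + \<alpha> \<cdot>\<^sub>v u 0 + \<beta> \<cdot>\<^sub>v u 1)"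
    then have i: "i < n" by (simp add: u_def)
    have *: "(B *\<^sub>v u 2) $ i = B $$ (i, 2)"
      using mult_mat_unit_vec[OF B, of 2] i n B by (simp add: u_def)
    consider "i = 0" | "i = 1" | "i = 2" | "3 \<le> i" by linarith
    then show "(B *\<^sub>v u 2) $ i = (a \<cdot>\<^sub>v u 2 + \<alpha> \<cdot>\<^sub>v u 0 + \<beta> \<cdot>\<^sub>v u 1) $ i"
      unfolding * by cases (use i n b22 b2 in \<open>auto simp: u_def \<alpha>_def \<beta>_def\<close>)
  qed (use B in \<open>simp add: u_def\<close>)
  have d0: "d \<noteq> 0"
  proof
    assume "d = 0"
    \<comment> \<open>If \<open>d = 0\<close>, this vector spans the kernel of the restriction of
      \<open>B\<close>.\<close>
    let ?v = "u 1 - a \<cdot>\<^sub>v u 0"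
    have "B *\<^sub>v ?v = B *\<^sub>v u 1 - a \<cdot>\<^sub>v (B *\<^sub>v u 0)"
      using mult_minus_distrib_mat_vec[OF B u, of "a \<cdot>\<^sub>v u 0" 1] mult_mat_vec[OF B u] u by simp
    also have "\<dots> = 0\<^sub>v n"
      unfolding Bu0 Bu1 \<open>d = 0\<close> by (intro eq_vecI) (auto simp: u_def)
    finally have "B *\<^sub>v ?v = 0\<^sub>v n" .
    moreover have "?v $ 1 = 1" using n by (simp add: u_def)
    then have "?v \<noteq> 0\<^sub>v n" using n by auto
    moreover have "?v \<in> carrier_vec n" using u by simp
    ultimately show False using det_0_iff_vec_prod_zero_field[OF B] dB by blast
  qed
  \<comment> \<open>The coefficients solve \<open>B v = a v + u 0\<close>: the one of
    \<open>u 0\<close> comes from comparing coordinate 1, then the one of \<open>u 1\<close> from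
    coordinate 0, dividing by \<open>d\<close>.\<close>
  define v where "v = u 2 + ((\<alpha> + \<beta> * a - 1) / d) \<cdot>\<^sub>v u 1 + (- \<beta>) \<cdot>\<^sub>v u 0"
  have v: "v \<in> carrier_vec n" using u by (simp add: v_def)
  have vi: "v $ i = (if i = 2 then 1 else if i = 1 then (\<alpha> + \<beta> * a - 1) / d else if i = 0 then - \<beta> else 0)"
    if "i < n" for i
    using that n by (auto simp: v_def u_def)
  have "B *\<^sub>v v = B *\<^sub>v u 2 + ((\<alpha> + \<beta> * a - 1) / d) \<cdot>\<^sub>v (B *\<^sub>v u 1) + (- \<beta>) \<cdot>\<^sub>v (B *\<^sub>v u 0)"
    using B u by (simp add: v_def mult_add_distrib_mat_vec[of _ n n] mult_mat_vec[OF B])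
  also have "\<dots> = a \<cdot>\<^sub>v v + u 0"
    unfolding Bu0 Bu1 Bu2 v_def using d0
    by (intro eq_vecI) (auto simp: u_def field_simps)
  finally have Bv: "B *\<^sub>v v = a \<cdot>\<^sub>v v + u 0" .
  have nx: "B *\<^sub>v v \<noteq> c \<cdot>\<^sub>v v" for c
  proof
    assume "B *\<^sub>v v = c \<cdot>\<^sub>v v"
    then have e: "(a \<cdot>\<^sub>v v + u 0) $ i = (c \<cdot>\<^sub>v v) $ i" for i using Bv by simp
    have "a = c" using e[of 2] n v vi[of 2] by (simp add: u_def)
    then show False using e[of 0] n v by (simp add: u_def)
  qed
  obtain C P where C: "sl_similar C B" "col C 0 = unit_vec n 1"
    and P: "P \<in> carrier_mat n n" "P *\<^sub>v col C 1 = B *\<^sub>v (B *\<^sub>v v)" "col P 0 = v" "col P 1 = B *\<^sub>v v"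
    by (rule sl_similar_cyclic_columns[OF n B v nx])
  have Cc: "C \<in> carrier_mat n n" using sl_similar_carrier[OF C(1) B] .
  \<comment> \<open>\<open>quad\<close> applied to \<open>C\<close> gives
    \<open>B (B v) = p v + q (B v)\<close>. Coordinate 2 then yields
    \<open>a * a = p + q * a\<close>, while coordinate 1 has an extra 1 on the left from
    \<open>u 1\<close>.\<close>
  define p q where "p = C $$ (0, 1)" and "q = C $$ (1, 1)"
  have "col C 1 = p \<cdot>\<^sub>v u 0 + q \<cdot>\<^sub>v u 1"
  proof (rule eq_vecI)
    fix i assume "i < dim_vec (p \<cdot>\<^sub>v u 0 + q \<cdot>\<^sub>v u 1)"
    then have i: "i < n" by (simp add: u_def)
    then show "col C 1 $ i = (p \<cdot>\<^sub>v u 0 + q \<cdot>\<^sub>v u 1) $ i"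
      using quad[OF C, of i] Cc n
      by (cases "i = 0"; cases "i = 1") (auto simp: u_def p_def q_def)
  qed (use Cc in \<open>simp add: u_def\<close>)
  then have "P *\<^sub>v col C 1 = p \<cdot>\<^sub>v (P *\<^sub>v u 0) + q \<cdot>\<^sub>v (P *\<^sub>v u 1)"
    using P(1) u by (simp add: mult_add_distrib_mat_vec[of _ n n] mult_mat_vec[OF P(1)])
  then have "B *\<^sub>v (B *\<^sub>v v) = p \<cdot>\<^sub>v v + q \<cdot>\<^sub>v (a \<cdot>\<^sub>v v + u 0)"
    using P Bv n mult_mat_unit_vec[OF P(1), of 0] mult_mat_unit_vec[OF P(1), of 1]
    by (simp add: u_def)
  moreover have "B *\<^sub>v (B *\<^sub>v v) = a \<cdot>\<^sub>v (a \<cdot>\<^sub>v v + u 0) + u 1"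
  proof -
    have "B *\<^sub>v (a \<cdot>\<^sub>v v + u 0) = a \<cdot>\<^sub>v (B *\<^sub>v v) + B *\<^sub>v u 0"
      using B v u by (simp add: mult_add_distrib_mat_vec[of _ n n] mult_mat_vec[OF B])
    then show ?thesis using Bv Bu0 by simp
  qed
  ultimately have e: "(a \<cdot>\<^sub>v (a \<cdot>\<^sub>v v + u 0) + u 1) $ i = (p \<cdot>\<^sub>v v + q \<cdot>\<^sub>v (a \<cdot>\<^sub>v v + u 0)) $ i" for i
    by simp
  have "a * a = p + q * a" using e[of 2] n v vi[of 2] by (simp add: u_def)
  moreover have "a * a * v $ 1 + 1 = (p + q * a) * v $ 1"
    using e[of 1] n v by (simp add: u_def algebra_simps)
  ultimately show False by simp
qed

lemma trace_surj_sl_similar: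
  fixes A B :: "'a :: field mat"
  assumes n: "3 \<le> n" and A: "A \<in> carrier_mat n n" and B: "B \<in> carrier_mat n n"
    and nsA: "\<not> scalar_mat n A" and nsB: "\<not> scalar_mat n B" and dB: "det B \<noteq> 0"
  shows "\<exists>A' B'. sl_similar A' A \<and> sl_similar B' B \<and> trace (A' * B') = c"
proof -
  obtain A1 where A1: "sl_similar A1 A" "col A1 0 = unit_vec n 2"
    using ex_sl_similar_col_0_eq_unit_vec_2[OF n A nsA] by blast
  obtain B1 where B1: "sl_similar B1 B" "col B1 0 = unit_vec n 1"
    using ex_sl_similar_col_0_eq_unit_vec_1[OF n B nsB] by blast
  have A1c: "A1 \<in> carrier_mat n n" using sl_similar_carrier[OF A1(1) A] .
  have B1c: "B1 \<in> carrier_mat n n" using sl_similar_carrier[OF B1(1) B] .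
  have "\<exists>C A' B'. sl_similar C B1 \<and> sl_similar A' A1 \<and> sl_similar B' C \<and> trace (A' * B') = c"
  \<comment> \<open>A conjugate with first column \<open>e\<^sub>1\<close> expresses the map in a
    basis starting with some \<open>x\<close> and its image; a nonzero entry \<open>(k, 1)\<close>
    with \<open>k \<ge> 2\<close> says that the second image of \<open>x\<close> leaves their
    span.\<close>
  proof (cases "\<exists>C k. sl_similar C B1 \<and> col C 0 = unit_vec n 1 \<and> 2 \<le> k \<and> k < n \<and> C $$ (k, 1) \<noteq> 0")
    case True
    then obtain C k where C: "sl_similar C B1" "col C 0 = unit_vec n 1"
      and k: "2 \<le> k" "k < n" "C $$ (k, 1) \<noteq> 0" by blast
    show ?thesis
      using trace_surj_non_quadratic[OF n A1c sl_similar_carrier[OF C(1) B1c] A1(2) C(2) k] C(1)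
      by blast
  next
    case False
    then have quad: "C $$ (k, 1) = 0"
      if "sl_similar C B1" "col C 0 = unit_vec n 1" "2 \<le> k" "k < n" for C k
      using that by blast
    have "similar_mat B1 B" using B1(1) unfolding sl_similar_def similar_mat_def by blast
    then have "det B1 \<noteq> 0" using det_similar dB by metis
    then obtain C where C: "sl_similar C B1" "col C 0 = unit_vec n 1" "C $$ (2, 2) \<noteq> C $$ (1, 1)"
      using ex_sl_similar_diagonal_entry[OF n B1c _ B1(2) quad] by blast
    have "C $$ (2, 1) = 0" using quad[OF C(1,2), of 2] n by simp
    then show ?thesis
      using trace_surj_diagonal_entry[OF n A1c sl_similar_carrier[OF C(1) B1c] A1(2) C(2) _ C(3)] C(1)
      by blast
  qed
  then show ?thesis using sl_similar_trans A1(1) B1(1) by metis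
qed

section \<open>Passage to conjugacy classes\<close>

lemma conjugacy_classes_SL:
  fixes \<Omega> :: "'a :: field mat set"
  assumes "\<Omega> \<in> conjugacy_classes (SL n)"
  obtains A where "A \<in> carrier_mat n n" "det A = 1" "A \<in> \<Omega>" "\<And>B. sl_similar B A \<Longrightarrow> B \<in> \<Omega>"
proof -
  interpret SL: group "SL n :: 'a mat monoid" by (rule group_SL)
  obtain A where A: "A \<in> carrier (SL n)"
    and \<Omega>: "\<Omega> = {g \<otimes>\<^bsub>SL n\<^esub> A \<otimes>\<^bsub>SL n\<^esub> inv\<^bsub>SL n\<^esub> g | g. g \<in> carrier (SL n)}"
    using assms unfolding conjugacy_classes_def orbits_def orbit_def by auto
  have Ac: "A \<in> carrier_mat n n" "det A = 1" using A by (auto simp: SL_def)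
  have mem: "B \<in> \<Omega>" if sim: "sl_similar B A" for B
  proof -
    obtain P Q where w: "similar_mat_wit B A P Q" and d: "det P = 1"
      using sim unfolding sl_similar_def by blast
    have Bc: "B \<in> carrier_mat n n" using sl_similar_carrier[OF sim Ac(1)] .
    note D = similar_mat_witD2[OF Bc w]
    have "det P * det Q = 1" using det_mult[OF D(6,7)] D(1) by simp
    then have PQ: "P \<in> carrier (SL n)" "Q \<in> carrier (SL n)"
      using d D by (auto simp: SL_def)
    \<comment> \<open>The group inverse of \<open>P\<close> is the matrix \<open>Q\<close> of the
      similarity witness, so the witness is literally a conjugation in the group.\<close>
    have "inv\<^bsub>SL n\<^esub> P = Q"
      using PQ D by (intro SL.inv_equality) (auto simp: SL_def)
    then have "B = P \<otimes>\<^bsub>SL n\<^esub> A \<otimes>\<^bsub>SL n\<^esub> inv\<^bsub>SL n\<^esub> P" using D(3) by (simp add: SL_def)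
    then show ?thesis using PQ unfolding \<Omega> by blast
  qed
  show thesis
    using that[OF Ac mem[OF sl_similar_refl[OF Ac(1)]] mem] .
qed

theorem theorem1p2:
  fixes n :: nat and \<Omega> \<Psi> :: "'a :: field mat set"
  assumes "n \<ge> 3"
    and "infinite (UNIV :: 'a set) \<Longrightarrow> n \<ge> 4"
    and "\<Omega> \<in> conjugacy_classes (SL n)"
    and "\<Psi> \<in> conjugacy_classes (SL n)"
    and "\<forall>\<omega>\<in>\<Omega>. \<not> scalar_mat n \<omega>"
    and "\<forall>\<psi>\<in>\<Psi>. \<not> scalar_mat n \<psi>"
  shows "{trace (\<omega> * \<psi>) | \<omega> \<psi>. \<omega> \<in> \<Omega> \<and> \<psi> \<in> \<Psi>} = UNIV"
proof -
  obtain A where A: "A \<in> carrier_mat n n" "det A = 1" "A \<in> \<Omega>" "\<And>X. sl_similar X A \<Longrightarrow> X \<in> \<Omega>"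
    using conjugacy_classes_SL[OF assms(3)] by blast
  obtain B where B: "B \<in> carrier_mat n n" "det B = 1" "B \<in> \<Psi>" "\<And>X. sl_similar X B \<Longrightarrow> X \<in> \<Psi>"
    using conjugacy_classes_SL[OF assms(4)] by blast
  have "\<exists>\<omega> \<psi>. c = trace (\<omega> * \<psi>) \<and> \<omega> \<in> \<Omega> \<and> \<psi> \<in> \<Psi>" for c
  proof -
    have "det B \<noteq> 0" using B(2) by simp
    then obtain \<omega> \<psi> where "sl_similar \<omega> A" "sl_similar \<psi> B" "trace (\<omega> * \<psi>) = c"
      using trace_surj_sl_similar[OF assms(1) A(1) B(1)] assms(5,6) A(3) B(3) by blast
    then show ?thesis using A(4) B(4) by blast
  qed
  then show ?thesis by blast
qed

end
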